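(* Let $K$ be an algebraically closed field, and let $k_1,k_2$ be positive integers. Consider the polynomial map $\widetilde{w}\colon \mathrm{M}(2,K)^2\to \mathrm{M}(2,K)$ given by $(x,y)\mapsto Ax^{k_1}+By^{k_2}$, where $A,B\in \mathrm{M}(2,K)$ are both non-zero. (i) $\widetilde{w}$ is surjective if and only if $A$ and $B$ can be simultaneously conjugated to a pair of matrices such that both the matrices do not have the same zero rows. (ii) Further, for a choice of $A,B$ up to simultaneous conjugation, the images of $\widetilde{w}$ are as described in the following list, and they are vector subspaces of $\mathrm{M}(2,K)$. Here $$T=\left\{\begin{pmatrix} s& t\\ 0&0\end{pmatrix}: s,t\in K\right\},\qquad L=\left\{\begin{pmatrix} 0& 0\\ s&t\end{pmatrix}: s,t\in K\right\},$$ and $\lambda,\mu,\xi,\xi_i,z\in K$ are subject to the displayed conditions and to $A\neq 0$, $B\neq 0$. The image is $\mathrm{M}(2,K)$ for: (1) $A=\mathrm{diag}(\lambda,\lambda)$, $B=\mathrm{diag}(\xi,\xi)$; (2) $A=\mathrm{diag}(\lambda,\lambda)$, $B=\mathrm{diag}(\xi_1,\xi_2)$, $\xi_1\ne\xi_2$; (3) $A=\mathrm{diag}(\lambda,\lambda)$, $B=\begin{pmatrix}\xi&1\\0&\xi\end{pmatrix}$; (4) $A=\mathrm{diag}(\lambda,\mu)$, $\lambda\neq\mu$, $B=\mathrm{diag}(\xi,\xi)$; (5) $A=\mathrm{diag}(\lambda,\mu)$, $\lambda\ne\mu$, $B=\mathrm{diag}(\xi_1,\xi_2)$, $\xi_1\xi_2\neq0$;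 (6) $A=\mathrm{diag}(\lambda,\mu)$, $\lambda\neq0$, $B=\mathrm{diag}(\xi_1,\xi_2)$, $\xi_2\neq0$; (7) $A=\mathrm{diag}(\lambda,\mu)$, $\mu\neq0$, $B=\mathrm{diag}(\xi_1,\xi_2)$, $\xi_1\neq0$; (8) $A=\mathrm{diag}(\lambda,\mu)$, $\lambda\mu\neq0$, $B=\begin{pmatrix}\xi&1\\0&\xi\end{pmatrix}$; (9) $A=\mathrm{diag}(\lambda,\mu)$, $\lambda\mu=0$, $B=\begin{pmatrix}\xi&1\\0&\xi\end{pmatrix}$, $\xi\ne0$; (10) $A=\mathrm{diag}(\lambda,\mu)$, $\mu\neq0$, $B=\begin{pmatrix}0&1\\0&0\end{pmatrix}$; (11) $A=\mathrm{diag}(\lambda,\mu)$, $\lambda\mu\neq0$, $B=\begin{pmatrix}\xi_1&1\\0&\xi_2\end{pmatrix}$, $\xi_1\neq\xi_2$; (12) $A=\mathrm{diag}(\lambda,\mu)$, $\lambda\mu=0$, $B=\begin{pmatrix}\xi_1&1\\0&\xi_2\end{pmatrix}$, $\xi_1\xi_2\neq0$; (13) $A=\mathrm{diag}(\lambda,\mu)$, $\mu\neq0$, $B=\begin{pmatrix}\xi&1\\0&0\end{pmatrix}$; (14) $A=\mathrm{diag}(\lambda,0)$, $B=\begin{pmatrix}0&1\\0&\xi\end{pmatrix}$, $\xi\neq0$; (15) $A=\mathrm{diag}(0,\mu)$, $B=\begin{pmatrix}0&1\\0&\xi\end{pmatrix}$; (16) $A=\mathrm{diag}(\lambda,\mu)$,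 $\lambda\mu\neq0$, $B=\begin{pmatrix}\xi&0\\1&\xi\end{pmatrix}$; (17) $A=\mathrm{diag}(\lambda,\mu)$, $\lambda\mu=0$, $B=\begin{pmatrix}\xi&0\\1&\xi\end{pmatrix}$, $\xi\neq0$; (18) $A=\mathrm{diag}(\lambda,\mu)$, $\lambda\neq0$, $B=\begin{pmatrix}0&0\\1&0\end{pmatrix}$; (19) $A=\mathrm{diag}(\lambda,\mu)$, $\lambda\mu\neq0$, $B=\begin{pmatrix}\xi_1&0\\1&\xi_2\end{pmatrix}$, $\xi_1\neq\xi_2$; (20) $A=\mathrm{diag}(\lambda,\mu)$, $\lambda\mu=0$, $B=\begin{pmatrix}\xi_1&0\\1&\xi_2\end{pmatrix}$, $\xi_1\xi_2\neq0$; (21) $A=\mathrm{diag}(\lambda,0)$, $B=\begin{pmatrix}\xi&0\\1&\xi_2\end{pmatrix}$; (22) $A=\mathrm{diag}(0,\mu)$, $B=\begin{pmatrix}\xi_1&0\\1&\xi_2\end{pmatrix}$, $\xi_1\neq0$; (23) $A=\mathrm{diag}(\lambda,\mu)$, $\lambda\neq\mu$, $B=\begin{pmatrix}\xi_1&\xi_2\\1&\xi_3\end{pmatrix}$, $\xi_1,\xi_2,\xi_3\neq0$; (24) $A=\mathrm{diag}(\lambda,\mu)$, $\lambda\mu\neq0$, $B=\begin{pmatrix}0&\xi_2\\1&\xi_3\end{pmatrix}$, $\xi_3\neq0$; (25) $A=\mathrm{diag}(\lambda,\mu)$, $B=\begin{pmatrix}0&\xi_2\\1&\xi_3\end{pmatrix}$,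 $\xi_2,\xi_3\neq0$; (26) $A=\mathrm{diag}(\lambda,\mu)$, $\lambda\neq\mu$, $B=\begin{pmatrix}\xi_1&\xi_2\\1&0\end{pmatrix}$, $\xi_1\neq0$; (27) $A=\mathrm{diag}(\lambda,\mu)$, $\lambda\neq\mu$, $B=\begin{pmatrix}0&\xi\\1&0\end{pmatrix}$, $\xi\neq0$; (28) $A=\begin{pmatrix}\lambda&1\\0&\lambda\end{pmatrix}$, $\lambda\neq0$, $B=\begin{pmatrix}\xi&0\\ z&\xi\end{pmatrix}$, $\xi z\neq0$; (29) $A=\begin{pmatrix}0&1\\0&0\end{pmatrix}$, $B=\begin{pmatrix}\xi_1&0\\ z&\xi_2\end{pmatrix}$, $\xi_1\neq\xi_2$, $z\neq0$; (30) $A=\begin{pmatrix}\lambda&1\\0&\lambda\end{pmatrix}$, $\lambda\neq0$, $B=\begin{pmatrix}\xi_1&0\\0&\xi_2\end{pmatrix}$, $\xi_1\neq\xi_2$; (31) $A=\begin{pmatrix}\lambda&1\\0&\lambda\end{pmatrix}$, $B=\begin{pmatrix}\xi&z\\0&\xi\end{pmatrix}$, $\xi\neq0$. The image is $T$ for: (32) $A=\mathrm{diag}(\lambda,0)$, $B=\mathrm{diag}(\xi,0)$; (33) $A=\mathrm{diag}(\lambda,0)$, $B=\begin{pmatrix}0&1\\0&0\end{pmatrix}$; (34) $A=\mathrm{diag}(\lambda,0)$, $B=\begin{pmatrix}\xi&1\\0&0\end{pmatrix}$; (35) $A=\begin{pmatrix}0&1\\0&0\end{pmatrix}$, $B=\begin{pmatrix}0&z\\0&0\end{pmatrix}$.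 The image is $L$ for: (36) $A=\mathrm{diag}(0,\mu)$, $B=\mathrm{diag}(0,\xi)$; (37) $A=\mathrm{diag}(0,\mu)$, $B=\begin{pmatrix}0&0\\1&0\end{pmatrix}$; (38) $A=\mathrm{diag}(0,\mu)$, $B=\begin{pmatrix}0&0\\1&\xi\end{pmatrix}$.
   Context: $\mathrm{M}(2,K)$ is the algebra of $2\times 2$ matrices over $K$, and $\mathrm{GL}(2,K)$ is its group of invertible elements. Simultaneously conjugating a pair $(A,B)$ of matrices in $\mathrm{M}(2,K)$ means replacing it by $(PAP^{-1},PBP^{-1})$ for a single $P\in\mathrm{GL}(2,K)$. That two matrices "do not have the same zero rows" means that the places of their zero rows are disjoint: there is no $i\in\{1,2\}$ for which the $i$-th row of both matrices is zero.
   Formalization: (i) is false for A=B=diag(1,0); it is proved with "some conjugate pair with A in Jordan form", and with "every conjugate pair", having no common zero row. (ii) The list misses pairs such as (E12,E21); six further families with A a Jordan block are added, with images M(2,K) or T. *)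

theory Defs
  imports "HOL-Analysis.Analysis" "HOL-Computational_Algebra.Computational_Algebra"
begin

definition mat2 :: "'a::zero \<Rightarrow> 'a \<Rightarrow> 'a \<Rightarrow> 'a \<Rightarrow> 'a^2^2" where
  "mat2 a b c d = vector [vector [a, b], vector [c, d]]"

abbreviation diag2 :: "'a::zero \<Rightarrow> 'a \<Rightarrow> 'a^2^2" where
  "diag2 a d \<equiv> mat2 a 0 0 d"

lemma mat2_nth [simp]:
  "mat2 a b c d $ 1 $ 1 = a" "mat2 a b c d $ 1 $ 2 = b"
  "mat2 a b c d $ 2 $ 1 = c" "mat2 a b c d $ 2 $ 2 = d"
  by (simp_all add: mat2_def)

(* The type class operations times and power on vectors are componentwise, so the power of a
   matrix has to be built from the matrix product. *)
definition mat_power :: "'a::semiring_1^'n^'n \<Rightarrow> nat \<Rightarrow> 'a^'n^'n" where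
  "mat_power X k = ((**) X ^^ k) (mat 1)"

definition word_map ::
  "nat \<Rightarrow> nat \<Rightarrow> 'a::semiring_1^2^2 \<Rightarrow> 'a^2^2 \<Rightarrow> ('a^2^2) \<times> ('a^2^2) \<Rightarrow> 'a^2^2" where
  "word_map k1 k2 A B = (\<lambda>(x, y). A ** mat_power x k1 + B ** mat_power y k2)"

definition conj_by :: "'a::semiring_1^2^2 \<Rightarrow> 'a^2^2 \<Rightarrow> 'a^2^2" where
  "conj_by P X = P ** X ** matrix_inv P"

definition disjoint_zero_rows :: "'a::zero^2^2 \<Rightarrow> 'a^2^2 \<Rightarrow> bool" where
  "disjoint_zero_rows A B \<longleftrightarrow> \<not> (\<exists>i. row i A = 0 \<and> row i B = 0)"

(* Jordan normal form, with the diagonal entries in either order; all pairs in the list below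
   have A of this shape.  It is needed for an existential reading of "can be conjugated to a
   pair without common zero rows", which fails for arbitrary conjugates: see
   disjoint_zero_rows_not_sufficient. *)
definition jordan_form2 :: "'a::{zero,one}^2^2 \<Rightarrow> bool" where
  "jordan_form2 A \<longleftrightarrow> (\<exists>l m. A = diag2 l m) \<or> (\<exists>l. A = mat2 l 1 0 l)"

abbreviation mat_scale :: "'a::times \<Rightarrow> 'a^'n^'m \<Rightarrow> 'a^'n^'m" where
  "mat_scale c \<equiv> map_matrix ((*) c)"

(* This makes the library's characterization of module.subspace available for matrices. *)
lemma module_mat_scale: "module (mat_scale :: 'a::comm_ring_1 \<Rightarrow> 'a^'n^'m \<Rightarrow> 'a^'n^'m)"
  by unfold_locales (simp_all add: vec_eq_iff algebra_simps)

definition top_rows :: "('a::zero^2^2) set" where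
  "top_rows = {mat2 s t 0 0 | s t. True}"

definition bottom_rows :: "('a::zero^2^2) set" where
  "bottom_rows = {mat2 0 0 s t | s t. True}"

(* listed A B V: the pair (A, B) is in the list, with image V.  The rules are in the order of
   the list, with l, m, x for lambda, mu, xi; that A and B are non-zero is a standing hypothesis and is not repeated in them. *)
inductive listed :: "'a::field^2^2 \<Rightarrow> 'a^2^2 \<Rightarrow> ('a^2^2) set \<Rightarrow> bool" where
  c1: "listed (diag2 l l) (diag2 x x) UNIV"
| c2: "x1 \<noteq> x2 \<Longrightarrow> listed (diag2 l l) (diag2 x1 x2) UNIV"
| c3: "listed (diag2 l l) (mat2 x 1 0 x) UNIV"
| c4: "l \<noteq> m \<Longrightarrow> listed (diag2 l m) (diag2 x x) UNIV"
| c5: "\<lbrakk>l \<noteq> m; x1 * x2 \<noteq> 0\<rbrakk> \<Longrightarrow> listed (diag2 l m) (diag2 x1 x2) UNIV"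
| c6: "\<lbrakk>l \<noteq> 0; x2 \<noteq> 0\<rbrakk> \<Longrightarrow> listed (diag2 l m) (diag2 x1 x2) UNIV"
| c7: "\<lbrakk>m \<noteq> 0; x1 \<noteq> 0\<rbrakk> \<Longrightarrow> listed (diag2 l m) (diag2 x1 x2) UNIV"
| c8: "l * m \<noteq> 0 \<Longrightarrow> listed (diag2 l m) (mat2 x 1 0 x) UNIV"
| c9: "\<lbrakk>l * m = 0; x \<noteq> 0\<rbrakk> \<Longrightarrow> listed (diag2 l m) (mat2 x 1 0 x) UNIV"
| c10: "m \<noteq> 0 \<Longrightarrow> listed (diag2 l m) (mat2 0 1 0 0) UNIV"
| c11: "\<lbrakk>l * m \<noteq> 0; x1 \<noteq> x2\<rbrakk> \<Longrightarrow> listed (diag2 l m) (mat2 x1 1 0 x2) UNIV"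
| c12: "\<lbrakk>l * m = 0; x1 * x2 \<noteq> 0\<rbrakk> \<Longrightarrow> listed (diag2 l m) (mat2 x1 1 0 x2) UNIV"
| c13: "m \<noteq> 0 \<Longrightarrow> listed (diag2 l m) (mat2 x 1 0 0) UNIV"
| c14: "x \<noteq> 0 \<Longrightarrow> listed (diag2 l 0) (mat2 0 1 0 x) UNIV"
| c15: "listed (diag2 0 m) (mat2 0 1 0 x) UNIV"
| c16: "l * m \<noteq> 0 \<Longrightarrow> listed (diag2 l m) (mat2 x 0 1 x) UNIV"
| c17: "\<lbrakk>l * m = 0; x \<noteq> 0\<rbrakk> \<Longrightarrow> listed (diag2 l m) (mat2 x 0 1 x) UNIV"
| c18: "l \<noteq> 0 \<Longrightarrow> listed (diag2 l m) (mat2 0 0 1 0) UNIV"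
| c19: "\<lbrakk>l * m \<noteq> 0; x1 \<noteq> x2\<rbrakk> \<Longrightarrow> listed (diag2 l m) (mat2 x1 0 1 x2) UNIV"
| c20: "\<lbrakk>l * m = 0; x1 * x2 \<noteq> 0\<rbrakk> \<Longrightarrow> listed (diag2 l m) (mat2 x1 0 1 x2) UNIV"
| c21: "listed (diag2 l 0) (mat2 x 0 1 x2) UNIV"
| c22: "x1 \<noteq> 0 \<Longrightarrow> listed (diag2 0 m) (mat2 x1 0 1 x2) UNIV"
| c23: "\<lbrakk>l \<noteq> m; x1 \<noteq> 0; x2 \<noteq> 0; x3 \<noteq> 0\<rbrakk> \<Longrightarrow> listed (diag2 l m) (mat2 x1 x2 1 x3) UNIV"
| c24: "\<lbrakk>l * m \<noteq> 0; x3 \<noteq> 0\<rbrakk> \<Longrightarrow> listed (diag2 l m) (mat2 0 x2 1 x3) UNIV"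
| c25: "\<lbrakk>x2 \<noteq> 0; x3 \<noteq> 0\<rbrakk> \<Longrightarrow> listed (diag2 l m) (mat2 0 x2 1 x3) UNIV"
| c26: "\<lbrakk>l \<noteq> m; x1 \<noteq> 0\<rbrakk> \<Longrightarrow> listed (diag2 l m) (mat2 x1 x2 1 0) UNIV"
| c27: "\<lbrakk>l \<noteq> m; x \<noteq> 0\<rbrakk> \<Longrightarrow> listed (diag2 l m) (mat2 0 x 1 0) UNIV"
| c28: "\<lbrakk>l \<noteq> 0; x * z \<noteq> 0\<rbrakk> \<Longrightarrow> listed (mat2 l 1 0 l) (mat2 x 0 z x) UNIV"
| c29: "\<lbrakk>x1 \<noteq> x2; z \<noteq> 0\<rbrakk> \<Longrightarrow> listed (mat2 0 1 0 0) (mat2 x1 0 z x2) UNIV"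
| c30: "\<lbrakk>l \<noteq> 0; x1 \<noteq> x2\<rbrakk> \<Longrightarrow> listed (mat2 l 1 0 l) (mat2 x1 0 0 x2) UNIV"
| c31: "x \<noteq> 0 \<Longrightarrow> listed (mat2 l 1 0 l) (mat2 x z 0 x) UNIV"
| c32: "listed (diag2 l 0) (diag2 x 0) top_rows"
| c33: "listed (diag2 l 0) (mat2 0 1 0 0) top_rows"
| c34: "listed (diag2 l 0) (mat2 x 1 0 0) top_rows"
| c35: "listed (mat2 0 1 0 0) (mat2 0 z 0 0) top_rows"
| c36: "listed (diag2 0 m) (diag2 0 x) bottom_rows"
| c37: "listed (diag2 0 m) (mat2 0 0 1 0) bottom_rows"
| c38: "listed (diag2 0 m) (mat2 0 0 1 x) bottom_rows"

(* The list does not represent all pairs up to simultaneous conjugation: pairs in which A is a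
   single Jordan block may be missing (see list_incomplete below).  These are the missing
   families, with their images. *)
inductive omitted :: "'a::field^2^2 \<Rightarrow> 'a^2^2 \<Rightarrow> ('a^2^2) set \<Rightarrow> bool" where
  o1: "\<lbrakk>l \<noteq> 0; x1 \<noteq> x2; z \<noteq> 0\<rbrakk> \<Longrightarrow> omitted (mat2 l 1 0 l) (mat2 x1 0 z x2) UNIV"
| o2: "\<lbrakk>l \<noteq> 0; z \<noteq> 0\<rbrakk> \<Longrightarrow> omitted (mat2 l 1 0 l) (mat2 0 0 z 0) UNIV"
| o3: "z \<noteq> 0 \<Longrightarrow> omitted (mat2 0 1 0 0) (mat2 x 0 z x) UNIV"
| o4: "\<lbrakk>x1 \<noteq> x2; x2 \<noteq> 0\<rbrakk> \<Longrightarrow> omitted (mat2 0 1 0 0) (mat2 x1 0 0 x2) UNIV"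
| o5: "\<lbrakk>l \<noteq> 0; z \<noteq> 0\<rbrakk> \<Longrightarrow> omitted (mat2 l 1 0 l) (mat2 0 z 0 0) UNIV"
| o6: "x \<noteq> 0 \<Longrightarrow> omitted (mat2 0 1 0 0) (mat2 x 0 0 0) top_rows"

lemma mat2_eq_iff: "X = mat2 a b c d \<longleftrightarrow>
    X $ 1 $ 1 = a \<and> X $ 1 $ 2 = b \<and> X $ 2 $ 1 = c \<and> X $ 2 $ 2 = d"
  by (auto simp: vec_eq_iff forall_2)

lemma mat2_mult: "mat2 a b c d ** mat2 a' b' c' d' =
    (mat2 (a*a' + b*c') (a*b' + b*d') (c*a' + d*c') (c*b' + d*d') :: 'a::semiring_1^2^2)"
  by (simp add: vec_eq_iff forall_2 matrix_matrix_mult_def sum_2)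

lemma mat2_zero_iff: "mat2 a b c d = 0 \<longleftrightarrow> a = 0 \<and> b = 0 \<and> c = 0 \<and> d = 0"
  by (auto simp: vec_eq_iff forall_2)

lemma matrix_inv_mult_left:
  assumes "invertible P"
  shows "matrix_inv P ** P = mat 1"
  using assms unfolding invertible_def matrix_inv_def by (rule someI2_ex) simp

lemma conj_by_mult:
  fixes P :: "'a::field^2^2"
  assumes "invertible P"
  shows "conj_by P X ** conj_by P Y = conj_by P (X ** Y)"
proof -
  have "matrix_inv P ** P = mat 1"
    using assms by (rule matrix_inv_mult_left)
  then have "matrix_inv P ** (P ** Z) = Z" for Z :: "'a^2^2"
    by (simp add: matrix_mul_assoc)
  then show ?thesis
    by (simp add: conj_by_def flip: matrix_mul_assoc)
qed

lemma conj_by_eq_0_iff: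
  fixes P :: "'a::field^2^2"
  assumes "invertible P"
  shows "conj_by P X = 0 \<longleftrightarrow> X = 0"
proof
  assume *: "conj_by P X = 0"
  have "X = matrix_inv P ** P ** X ** (matrix_inv P ** P)"
    using assms by (simp add: matrix_inv_mult_left)
  also have "\<dots> = matrix_inv P ** conj_by P X ** P"
    by (simp add: conj_by_def matrix_mul_assoc)
  finally show "X = 0"
    using * by (simp add: matrix_mul_assoc)
qed (simp add: conj_by_def)

(* For surjectivity it does not suffice that some simultaneous conjugate has disjoint zero rows:
   E11 is conjugate to a matrix without zero rows. *)
lemma disjoint_zero_rows_not_sufficient:
  fixes A :: "'a::field^2^2"
  assumes A: "A = diag2 1 0"
  shows "\<exists>P. invertible P \<and> disjoint_zero_rows (conj_by P A) (conj_by P A)"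
    and "\<not> surj (word_map k1 k2 A A)"
proof -
  define P Q :: "'a^2^2" where "P = mat2 1 0 1 1" and "Q = mat2 1 0 (-1) 1"
  have one: "mat2 1 0 0 1 = (mat 1 :: 'a^2^2)"
    by (simp add: vec_eq_iff forall_2 mat_def)
  have PQ: "P ** Q = mat 1" "Q ** P = mat 1"
    by (simp_all add: P_def Q_def mat2_mult one)
  have inv: "invertible P"
    using PQ by (auto simp: invertible_def)
  have Q: "matrix_inv P = Q"
    using matrix_inv_mult_left[OF inv] PQ(1)
    by (metis matrix_mul_assoc matrix_mul_lid matrix_mul_rid)
  have "conj_by P A = mat2 1 0 1 0"
    unfolding conj_by_def Q by (simp add: A P_def Q_def mat2_mult)
  then have "disjoint_zero_rows (conj_by P A) (conj_by P A)"
    by (simp add: disjoint_zero_rows_def row_def vec_eq_iff forall_2)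
  with inv show "\<exists>P. invertible P \<and> disjoint_zero_rows (conj_by P A) (conj_by P A)"
    by blast
  have "word_map k1 k2 A A p $ 2 $ 2 = 0" for p
    by (simp add: word_map_def A matrix_matrix_mult_def sum_2 split: prod.split)
  moreover have "(mat 1 :: 'a^2^2) $ 2 $ 2 \<noteq> 0"
    by (simp add: mat_def)
  ultimately show "\<not> surj (word_map k1 k2 A A)"
    unfolding surj_def by metis
qed

lemma list_incomplete:
  fixes P :: "'a::field^2^2"
  assumes P: "invertible P"
  shows "\<not> listed (conj_by P (mat2 0 1 0 0)) (conj_by P (mat2 0 0 1 0)) V"
proof
  let ?A = "conj_by P (mat2 0 1 0 0)" and ?B = "conj_by P (mat2 0 0 1 0)"
  have "?A ** ?A = 0" "?B ** ?B = 0" "?A ** ?B \<noteq> 0" "?A \<noteq> 0" "?B \<noteq> 0"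
    using P by (simp_all add: conj_by_mult conj_by_eq_0_iff mat2_mult mat2_zero_iff)
  moreover assume "listed ?A ?B V"
  moreover have "listed X Y V \<Longrightarrow> X ** X = 0 \<Longrightarrow> Y ** Y = 0 \<Longrightarrow> X ** Y \<noteq> 0 \<Longrightarrow>
      X \<noteq> 0 \<Longrightarrow> Y \<noteq> 0 \<Longrightarrow> False" for X Y :: "'a^2^2"
    by (induction rule: listed.induct) (auto simp: mat2_mult mat2_zero_iff)
  ultimately show False
    by blast
qed

end

theory Submission
  imports Defs
begin

text \<open>
  The powers in the word impose no restriction: the image of \<open>(x, y) \<mapsto> A x\<^sup>k + B y\<^sup>l\<close> equals the
  image of the linear map \<open>(X, Y) \<mapsto> A X + B Y\<close> (\<open>range_word_map\<close>), that is, the space of all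
  matrices whose columns lie in the sum of the column spaces of \<open>A\<close> and \<open>B\<close>. Everything else is
  linear algebra.

  Not every matrix is a \<open>k\<close>-th power (nonzero nilpotent matrices are not when \<open>k\<close> is at least two,
  and nontrivial Jordan blocks need not be in positive characteristic), but every combination
  \<open>a E + b (1 - E)\<close> with \<open>E\<close> idempotent is one: take roots of \<open>a\<close> and \<open>b\<close>
  (\<open>spectral_has_root\<close>). There are enough of these:

  \<^item> If \<open>A\<close> is singular and nonzero, then \<open>A X\<close> depends only on the product of one nonzero row
    of \<open>A\<close> with \<open>X\<close>. A prescribed value of that product is attained by a scalar matrix or
    by an idempotent (\<open>singular_mult_power\<close>). If \<open>A\<close> and \<open>B\<close> are both singular, this treats the
    two summands independently.
  \<^item> If \<open>A\<close> is invertible, then \<open>A x\<^sup>k + B y\<^sup>l = M\<close> becomes \<open>x\<^sup>k = N - C y\<^sup>l\<close> with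
    \<open>N = A\<^sup>-\<^sup>1 M\<close> and \<open>C = A\<^sup>-\<^sup>1 B \<noteq> 0\<close>. For a suitable idempotent \<open>Y\<close> the discriminant of the
    characteristic polynomial of \<open>N - t C Y\<close> is a quadratic polynomial in \<open>t\<close>, so it equals \<open>1\<close> for
    some \<open>t\<close>; then \<open>N - t C Y\<close> has two distinct eigenvalues and is therefore of the required
    form, as is \<open>t Y\<close> (\<open>word_map_surj_if_invertible\<close>). The case of invertible \<open>B\<close> is symmetric.

  Consequently the word map is surjective exactly if no nonzero row vector annihilates both
  \<open>A\<close> and \<open>B\<close> (\<open>surj_word_map_iff\<close>). Such a vector can be made a row of a conjugating matrix \<open>P\<close>,
  and then the conjugates have a common zero row. If \<open>A\<close> is already in Jordan form and is
  singular and nonzero, then its left annihilator is spanned by a unit vector, so that a common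
  annihilating vector is visible as a common zero row without further conjugation.

  For the list, \<open>A\<close> is brought to Jordan form, and \<open>B\<close> is then normalized by matrices that commute
  with \<open>A\<close>: diagonal ones if \<open>A\<close> has distinct eigenvalues, all of them if \<open>A\<close> is scalar, and
  unipotent upper triangular ones (shears) if \<open>A\<close> is a Jordan block.
\<close>

text \<open>
  Coefficients of power series are written with the same infix symbol as components of vectors, which
  gives a formula exponentially many parse trees in the number of matrix components that it mentions.
\<close>

no_notation fps_nth (infixl "$" 75)

section \<open>Matrix arithmetic\<close>

lemma mat2_exhaust:
  fixes X :: "'a::zero^2^2"
  obtains a b c d where "X = mat2 a b c d"
  using mat2_eq_iff[of X] by blast

lemma mat2_arith:
  fixes a :: "'a::comm_ring_1"
  shows "mat2 a b c d + mat2 a' b' c' d' = mat2 (a + a') (b + b') (c + c') (d + d')"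
    and "mat2 a b c d - mat2 a' b' c' d' = mat2 (a - a') (b - b') (c - c') (d - d')"
    and "mat_scale r (mat2 a b c d) = mat2 (r * a) (r * b) (r * c) (r * d)"
    and "(mat 1 :: 'a^2^2) = mat2 1 0 0 1"
  by (simp_all add: vec_eq_iff forall_2 mat_def)

lemma mat2_inject: "mat2 a b c d = mat2 a' b' c' d' \<longleftrightarrow> a = a' \<and> b = b' \<and> c = c' \<and> d = d'"
  by (simp add: mat2_eq_iff)

lemma mat_scale_mult:
  fixes X :: "'a::comm_semiring_1^'n^'m" and Y :: "'a^'p^'n"
  shows "mat_scale a X ** Y = mat_scale a (X ** Y)"
    and "X ** mat_scale b Y = mat_scale b (X ** Y)"
  by (simp_all add: vec_eq_iff matrix_matrix_mult_def sum_distrib_left mult_ac)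

lemma matrix_diff_distrib:
  fixes A :: "'a::ring_1^'n^'m" and B C :: "'a^'p^'n"
  shows "A ** (B - C) = A ** B - A ** C"
  by (simp add: vec_eq_iff matrix_matrix_mult_def sum_subtractf algebra_simps)

lemma matrix_diff_rdistrib:
  fixes A B :: "'a::ring_1^'n^'m" and C :: "'a^'p^'n"
  shows "(A - B) ** C = A ** C - B ** C"
  by (simp add: vec_eq_iff matrix_matrix_mult_def sum_subtractf algebra_simps)

lemma matrix_add_rdistrib:
  fixes A B :: "'a::semiring_1^'n^'m" and C :: "'a^'p^'n"
  shows "(A + B) ** C = A ** C + B ** C"
  by (simp add: vec_eq_iff matrix_matrix_mult_def sum.distrib algebra_simps)

section \<open>Matrices that have roots of all orders\<close>

text \<open>
  If \<open>E\<close> is idempotent, this is the diagonalizable matrix that acts as \<open>a\<close> on the column space of \<open>E\<close>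
  and as \<open>b\<close> on its kernel. Scalar matrices, multiples of idempotents and matrices with two distinct
  eigenvalues are all of this form.
\<close>

definition spectral :: "'a::comm_ring_1^'n^'n \<Rightarrow> 'a \<Rightarrow> 'a \<Rightarrow> 'a^'n^'n" where
  "spectral E a b = mat_scale a E + mat_scale b (mat 1 - E)"

text \<open>
  The idempotents \<open>E\<close> and \<open>1 - E\<close> are orthogonal, so products are computed on each of them separately.
\<close>

lemma spectral_mult:
  assumes "E ** E = E"
  shows "spectral E a b ** spectral E c d = spectral E (a * c) (b * d)"
proof -
  have "spectral E a b ** spectral E c d =
      mat_scale (a * c) (E ** E) + mat_scale (a * d) (E - E ** E) +
      mat_scale (b * c) (E - E ** E) + mat_scale (b * d) (mat 1 - E - (E - E ** E))"
    by (simp add: spectral_def matrix_add_ldistrib matrix_add_rdistrib mat_scale_mult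
        matrix_diff_distrib matrix_diff_rdistrib) (simp add: vec_eq_iff algebra_simps)
  then show ?thesis
    unfolding assms by (simp add: spectral_def vec_eq_iff)
qed

lemma mat_power_spectral:
  assumes "E ** E = E"
  shows "mat_power (spectral E a b) k = spectral E (a ^ k) (b ^ k)"
proof (induction k)
  case 0
  then show ?case by (simp add: mat_power_def spectral_def vec_eq_iff)
next
  case (Suc k)
  have "mat_power (spectral E a b) (Suc k) = spectral E a b ** mat_power (spectral E a b) k"
    by (simp add: mat_power_def)
  then show ?case by (simp add: Suc spectral_mult assms)
qed

lemma spectral_has_root:
  fixes E :: "'a::alg_closed_field^'n^'n"
  assumes "E ** E = E" and "k > 0"
  obtains Z where "mat_power Z k = spectral E a b"
proof -
  obtain r s where "r ^ k = a" "s ^ k = b"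
    using nth_root_exists[OF \<open>k > 0\<close>] by meson
  then show ?thesis
    using mat_power_spectral[OF assms(1), of r s k] that by metis
qed

lemma quadratic_has_root:
  fixes a b c :: "'a::alg_closed_field"
  assumes "a \<noteq> 0"
  obtains t where "a * t\<^sup>2 + b * t + c = 0"
proof -
  have "degree [:c, b, a:] > 0"
    using assms by simp
  then obtain t where "poly [:c, b, a:] t = 0"
    using alg_closed_imp_poly_has_root by blast
  then show ?thesis
    using that[of t] by (simp add: power2_eq_square algebra_simps)
qed

text \<open>
  The discriminant \<open>tr\<^sup>2 - 4 det\<close> of the characteristic polynomial, in a form that makes clear that
  it is a quadratic form in the entries.
\<close>

definition disc :: "'a::comm_ring_1^2^2 \<Rightarrow> 'a" where
  "disc X = (X$1$1 - X$2$2)\<^sup>2 + 4 * (X$1$2 * X$2$1)"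

text \<open>
  The discriminant is \<open>(a - b)\<^sup>2\<close> for the eigenvalues \<open>a\<close> and \<open>b\<close>, in every characteristic. If they
  are distinct, then by Cayley-Hamilton \<open>(X - b) / (a - b)\<close> is an idempotent, namely the projection onto
  the eigenspace of \<open>a\<close>.
\<close>

lemma disc_nonzero_imp_spectral:
  fixes X :: "'a::alg_closed_field^2^2"
  assumes "disc X \<noteq> 0"
  obtains E a b where "E ** E = E" "X = spectral E a b"
proof -
  obtain x y z w where X: "X = mat2 x y z w"
    by (rule mat2_exhaust)
  obtain a where "1 * a\<^sup>2 + (- (x + w)) * a + (x * w - y * z) = 0"
    by (rule quadratic_has_root[of 1]) auto
  then have a: "y * z = a\<^sup>2 - (x + w) * a + x * w"
    by (simp add: algebra_simps add_eq_0_iff)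
  \<comment> \<open>The second eigenvalue, read off from the trace.\<close>
  define b where "b = x + w - a"
  have w: "w = a + b - x"
    by (simp add: b_def)
  \<comment> \<open>The Cayley-Hamilton identity for \<open>X\<close>, reduced to a single entry.\<close>
  have yz: "y * z = (x - b) * (a - x)"
    by (simp add: a w power2_eq_square algebra_simps)
  have "disc X = (x - w)\<^sup>2 + 4 * (y * z)"
    by (simp add: X disc_def)
  also have "\<dots> = (a - b)\<^sup>2"
    unfolding yz w by (simp add: power2_eq_square algebra_simps)
  finally have ne: "a - b \<noteq> 0"
    using assms by auto
  define E where "E = mat_scale (1 / (a - b)) (mat2 (x - b) y z (w - b))"
  have "mat2 (x - b) y z (w - b) ** mat2 (x - b) y z (w - b) =
      mat_scale (a - b) (mat2 (x - b) y z (w - b))"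
    using yz by (simp add: w mat2_mult mat2_arith mat2_inject algebra_simps)
  then have "E ** E = E"
    using ne unfolding E_def by (simp add: mat_scale_mult) (simp add: vec_eq_iff)
  moreover have "X = spectral E a b"
    using ne by (simp add: X E_def spectral_def mat2_arith mat2_inject divide_simps)
      (simp add: algebra_simps)
  ultimately show ?thesis by (rule that)
qed

section \<open>The image of the word map\<close>

text \<open>
  For \<open>Y\<close> of rank one \<open>C Y\<close> is singular, and its discriminant is the square of the trace of \<open>C Y\<close>. As
  the idempotents of rank one span all matrices and the trace form is nondegenerate, some
  idempotent \<open>Y\<close> makes it nonzero. The four idempotents below are such a spanning set.
\<close>

lemma idempotent_with_disc_nonzero:
  fixes C :: "'a::field^2^2"
  assumes "C \<noteq> 0"
  obtains Y where "Y ** Y = Y" "disc (C ** Y) \<noteq> 0"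
proof -
  obtain a b c d where C: "C = mat2 a b c d"
    by (rule mat2_exhaust)
  note facts = C mat2_mult disc_def power2_eq_square
  consider "a \<noteq> 0" | "d \<noteq> 0" | "a = 0" "c \<noteq> 0" | "a = 0" "b \<noteq> 0"
    using assms C by (auto simp: mat2_zero_iff)
  then show ?thesis
  proof cases
    case 1
    then show ?thesis by (intro that[of "mat2 1 0 0 0"]) (simp_all add: facts)
  next
    case 2
    then show ?thesis by (intro that[of "mat2 0 0 0 1"]) (simp_all add: facts)
  next
    case 3
    then show ?thesis by (intro that[of "mat2 1 1 0 0"]) (simp_all add: facts)
  next
    case 4
    then show ?thesis by (intro that[of "mat2 1 0 1 0"]) (simp_all add: facts)
  qed
qed

text \<open>
  Substituting \<open>y\<^sup>l = t Y\<close> with \<open>Y\<close> idempotent leaves the requirement that \<open>N - t C Y\<close> be a \<open>k\<close>-th power.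
  Its discriminant is a polynomial in \<open>t\<close> with leading coefficient \<open>disc (C ** Y)\<close>, so if this is
  nonzero, then some \<open>t\<close> makes the discriminant equal to \<open>1\<close>.
\<close>

lemma word_map_surj_if_invertible:
  fixes A B :: "'a::alg_closed_field^2^2"
  assumes "k1 > 0" "k2 > 0" and A: "invertible A" and "B \<noteq> 0"
  shows "surj (word_map k1 k2 A B)"
proof -
  obtain A' where A': "A ** A' = mat 1" "A' ** A = mat 1"
    using A by (auto simp: invertible_def)
  define C where "C = A' ** B"
  have AC: "A ** C = B"
    by (simp add: C_def matrix_mul_assoc A')
  then have "C \<noteq> 0"
    using \<open>B \<noteq> 0\<close> by auto
  then obtain Y where Y: "Y ** Y = Y" "disc (C ** Y) \<noteq> 0"
    by (rule idempotent_with_disc_nonzero)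
  have "\<exists>p. word_map k1 k2 A B p = M" for M
  proof -
    define N where "N = A' ** M"
    have AN: "A ** N = M"
      by (simp add: N_def matrix_mul_assoc A')
    define D where "D = C ** Y"
    \<comment> \<open>\<open>- b\<close> is the polarization \<open>disc (N + D) - disc N - disc D\<close> of the quadratic form.\<close>
    define b where "b = - 2 * ((N$1$1 - N$2$2) * (D$1$1 - D$2$2)) - 4 * (N$1$2 * D$2$1 + D$1$2 * N$2$1)"
    obtain t where "disc D * t\<^sup>2 + b * t + (disc N - 1) = 0"
      by (rule quadratic_has_root[OF Y(2)[folded D_def]])
    moreover have "disc (N - mat_scale t D) = disc D * t\<^sup>2 + b * t + disc N"
      by (simp add: b_def disc_def power2_eq_square algebra_simps)
    ultimately have "disc (N - mat_scale t D) = 1"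
      by (simp add: algebra_simps)
    then obtain E p q where "E ** E = E" and "N - mat_scale t D = spectral E p q"
      using disc_nonzero_imp_spectral[of "N - mat_scale t D"] by auto
    then obtain x where x: "mat_power x k1 = N - mat_scale t D"
      using spectral_has_root[OF _ \<open>k1 > 0\<close>] by metis
    have "mat_scale t Y = spectral Y t 0"
      by (simp add: spectral_def vec_eq_iff)
    then obtain y where y: "mat_power y k2 = mat_scale t Y"
      using spectral_has_root[OF Y(1) \<open>k2 > 0\<close>] by metis
    have "word_map k1 k2 A B (x, y) = A ** N - mat_scale t (A ** C ** Y) + mat_scale t (B ** Y)"
      by (simp add: word_map_def x y matrix_diff_distrib mat_scale_mult D_def matrix_mul_assoc)
    then show ?thesis
      by (metis AC AN diff_add_cancel)
  qed
  then show ?thesis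
    unfolding surj_def by metis
qed

text \<open>
  A singular \<open>A\<close> is a column times a nonzero row \<open>(p, q)\<close>, so only \<open>(m, n) = (p, q) X\<close> matters for \<open>A X\<close>.
  If the two rows are proportional, then \<open>X\<close> can be replaced by a scalar matrix. Otherwise there is a
  column \<open>(f, g)\<close> on which both rows take the value \<open>1\<close>, and the column \<open>(f, g)\<close> times the
  row \<open>(m, n)\<close> is an idempotent that \<open>(p, q)\<close> maps to \<open>(m, n)\<close>.
\<close>

lemma singular_mult_power:
  fixes A X :: "'a::alg_closed_field^2^2"
  assumes "k > 0" and A: "\<not> invertible A" "A \<noteq> 0"
  obtains Z where "A ** mat_power Z k = A ** X"
proof -
  obtain a b c d where A2: "A = mat2 a b c d"
    by (rule mat2_exhaust)
  obtain x y z w where X: "X = mat2 x y z w"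
    by (rule mat2_exhaust)
  have det: "a * d = b * c"
    using A(1) by (simp add: invertible_det_nz det_2 A2)
  obtain p q u v where pq: "p \<noteq> 0 \<or> q \<noteq> 0"
    and A_outer: "A = mat2 (u * p) (u * q) (v * p) (v * q)"
  proof (cases "a = 0 \<and> b = 0")
    case True
    then show ?thesis
      using A(2) that[of c d 0 1] by (auto simp: A2 mat2_zero_iff)
  next
    case False
    show ?thesis
    proof (cases "a = 0")
      case True
      with False det show ?thesis
        using that[of a b 1 "d / b"] by (auto simp: A2 mat2_inject)
    next
      case a: False
      with det show ?thesis
        using that[of a b 1 "c / a"] by (auto simp: A2 mat2_inject field_simps)
    qed
  qed
  define m n where "m = p * x + q * z" and "n = p * y + q * w"
  have AX: "A ** X = mat2 (u * m) (u * n) (v * m) (v * n)"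
    by (simp add: A_outer X mat2_mult m_def n_def algebra_simps)
  show ?thesis
  proof (cases "p * n = q * m")
    case True
    \<comment> \<open>The factor by which \<open>(m, n)\<close> is a multiple of \<open>(p, q)\<close>.\<close>
    define r where "r = (if p = 0 then n / q else m / p)"
    have r: "p * r = m" "q * r = n"
      using True pq by (auto simp: r_def field_simps)
    have idem: "(mat 1 :: 'a^2^2) ** mat 1 = mat 1"
      by simp
    obtain Z where "mat_power Z k = spectral (mat 1 :: 'a^2^2) r r"
      by (rule spectral_has_root[OF idem \<open>k > 0\<close>])
    also have "\<dots> = mat2 r 0 0 r"
      by (simp add: spectral_def vec_eq_iff forall_2 mat_def)
    finally have "A ** mat_power Z k = A ** X"
      unfolding AX by (simp add: A_outer mat2_mult mult.assoc r)
    then show ?thesis by (rule that)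
  next
    case False
    define D where "D = p * n - q * m"
    \<comment> \<open>Cramer's rule for \<open>p f + q g = 1\<close> and \<open>m f + n g = 1\<close>.\<close>
    define f g where "f = (n - q) / D" and "g = (p - m) / D"
    have "D \<noteq> 0"
      using False by (simp add: D_def)
    have eq1: "p * f + q * g = 1"
    proof -
      have "p * (n - q) + q * (p - m) = D"
        by (simp add: D_def algebra_simps)
      then show ?thesis
        using \<open>D \<noteq> 0\<close> by (simp add: f_def g_def flip: add_divide_distrib)
    qed
    have eq2: "m * f + n * g = 1"
    proof -
      have "m * (n - q) + n * (p - m) = D"
        by (simp add: D_def algebra_simps)
      then show ?thesis
        using \<open>D \<noteq> 0\<close> by (simp add: f_def g_def flip: add_divide_distrib)
    qed
    define E where "E = mat2 (f * m) (f * n) (g * m) (g * n)"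
    have "E ** E = mat_scale (m * f + n * g) E"
      by (simp add: E_def mat2_mult mat2_arith mat2_inject algebra_simps)
    then have idem: "E ** E = E"
      by (simp add: eq2 vec_eq_iff)
    obtain Z where "mat_power Z k = spectral E 1 0"
      by (rule spectral_has_root[OF idem \<open>k > 0\<close>])
    also have "\<dots> = E"
      by (simp add: spectral_def vec_eq_iff)
    finally have "A ** mat_power Z k = mat_scale (p * f + q * g) (A ** X)"
      unfolding AX by (simp add: A_outer E_def mat2_mult mat2_arith mat2_inject algebra_simps)
    then have "A ** mat_power Z k = A ** X"
      by (simp add: eq1 vec_eq_iff)
    then show ?thesis by (rule that)
  qed
qed

lemma word_map_swap: "word_map k1 k2 A B (x, y) = word_map k2 k1 B A (y, x)"
  by (simp add: word_map_def add.commute)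

text \<open>
  The powers do not shrink the image: if \<open>A\<close> or \<open>B\<close> is invertible, then already the word map is
  surjective, and otherwise each of the two summands takes all the values that it would take for
  arbitrary matrices in place of powers.
\<close>

theorem range_word_map:
  fixes A B :: "'a::alg_closed_field^2^2"
  assumes k: "k1 > 0" "k2 > 0" and ne: "A \<noteq> 0" "B \<noteq> 0"
  shows "range (word_map k1 k2 A B) = {A ** X + B ** Y | X Y. True}"
proof
  show "range (word_map k1 k2 A B) \<subseteq> {A ** X + B ** Y | X Y. True}"
    by (auto simp: word_map_def)
  show "{A ** X + B ** Y | X Y. True} \<subseteq> range (word_map k1 k2 A B)"
  proof (cases "invertible A \<or> invertible B")
    case True
    have "surj (word_map k1 k2 A B)" if "\<not> invertible A"
    proof -
      have "surj (word_map k2 k1 B A)"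
        using True that k ne by (intro word_map_surj_if_invertible) auto
      then show ?thesis
        unfolding surj_def by (metis word_map_swap surj_pair)
    qed
    then have "surj (word_map k1 k2 A B)"
      using word_map_surj_if_invertible[OF k _ ne(2)] by blast
    then show ?thesis by simp
  next
    case False
    have "A ** X + B ** Y \<in> range (word_map k1 k2 A B)" for X Y
    proof -
      obtain x where x: "A ** mat_power x k1 = A ** X"
        using False k ne singular_mult_power by metis
      obtain y where y: "B ** mat_power y k2 = B ** Y"
        using False k ne singular_mult_power by metis
      have "word_map k1 k2 A B (x, y) = A ** X + B ** Y"
        by (simp add: word_map_def x y)
      then show ?thesis by (metis rangeI)
    qed
    then show ?thesis by blast
  qed
qed

lemma subspace_range_word_map:
  fixes A B :: "'a::alg_closed_field^2^2"
  assumes "k1 > 0" "k2 > 0" "A \<noteq> 0" "B \<noteq> 0"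
  shows "module.subspace mat_scale (range (word_map k1 k2 A B))"
  unfolding module.subspace_def[OF module_mat_scale]
proof (intro conjI ballI allI)
  let ?S = "range (word_map k1 k2 A B)"
  note S = range_word_map[OF assms]
  have "0 = A ** 0 + B ** 0" by simp
  then show "0 \<in> ?S" unfolding S by blast
  show "P + Q \<in> ?S" if PQ: "P \<in> ?S" "Q \<in> ?S" for P Q :: "'a^2^2"
  proof -
    obtain X Y X' Y' where "P = A ** X + B ** Y" "Q = A ** X' + B ** Y'"
      using PQ unfolding S by blast
    then have "P + Q = A ** (X + X') + B ** (Y + Y')"
      by (simp add: matrix_add_ldistrib)
    then show ?thesis unfolding S by blast
  qed
  show "mat_scale c P \<in> ?S" if P: "P \<in> ?S" for c :: 'a and P :: "'a^2^2"
  proof -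
    obtain X Y where "P = A ** X + B ** Y"
      using P unfolding S by blast
    then have "mat_scale c P = A ** mat_scale c X + B ** mat_scale c Y"
      unfolding mat_scale_mult by (simp add: vec_eq_iff algebra_simps)
    then show ?thesis unfolding S by blast
  qed
qed

section \<open>Surjectivity and common left kernels\<close>

definition common_left_kernel :: "'a::semiring_1^'n^'m \<Rightarrow> 'a^'p^'m \<Rightarrow> ('a^'m) set" where
  "common_left_kernel A B = {w. w v* A = 0 \<and> w v* B = 0}"

text \<open>
  The left kernel of the block matrix \<open>C = (A | B)\<close> is the common left kernel of \<open>A\<close> and \<open>B\<close>, and a right
  inverse of \<open>C\<close> is a solution \<open>(X, Y)\<close> stacked on top of each other. A matrix over a field has a right
  inverse exactly if its rows are independent.
\<close>

lemma column_spaces_span_iff: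
  fixes A :: "'a::field^'n^'m" and B :: "'a^'p^'m"
  shows "(\<exists>X Y. A ** X + B ** Y = mat 1) \<longleftrightarrow> common_left_kernel A B = {0}"
proof -
  define C :: "'a^('n + 'p)^'m" where
    "C = (\<chi> i j. case j of Inl j \<Rightarrow> A $ i $ j | Inr j \<Rightarrow> B $ i $ j)"
  have sum_split: "(\<Sum>j\<in>UNIV. f j) = (\<Sum>j\<in>UNIV. f (Inl j)) + (\<Sum>j\<in>UNIV. f (Inr j))"
    for f :: "'n + 'p \<Rightarrow> 'a"
    by (subst UNIV_Plus_UNIV[symmetric], subst sum.Plus) simp_all
  have all_split: "(\<forall>j. P j) \<longleftrightarrow> (\<forall>j. P (Inl j)) \<and> (\<forall>j. P (Inr j))" for P :: "'n + 'p \<Rightarrow> bool"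
    by (metis sum.exhaust)
  have "(\<exists>X Y. A ** X + B ** Y = mat 1) \<longleftrightarrow> (\<exists>D. C ** D = mat 1)"
  proof
    assume "\<exists>X Y. A ** X + B ** Y = mat 1"
    then obtain X Y where XY: "A ** X + B ** Y = mat 1" by blast
    have "C ** (\<chi> j. case j of Inl j \<Rightarrow> X $ j | Inr j \<Rightarrow> Y $ j) = A ** X + B ** Y"
      by (simp add: vec_eq_iff matrix_matrix_mult_def sum_split C_def)
    with XY show "\<exists>D. C ** D = mat 1" by metis
  next
    assume "\<exists>D. C ** D = mat 1"
    then obtain D where D: "C ** D = mat 1" by blast
    have "C ** D = A ** (\<chi> j. D $ Inl j) + B ** (\<chi> j. D $ Inr j)"
      by (simp add: vec_eq_iff matrix_matrix_mult_def sum_split C_def)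
    with D show "\<exists>X Y. A ** X + B ** Y = mat 1" by metis
  qed
  also have "\<dots> \<longleftrightarrow> (\<forall>c. (\<Sum>i\<in>UNIV. c i *s row i C) = 0 \<longrightarrow> (\<forall>i. c i = 0))"
    by (rule matrix_right_invertible_independent_rows)
  also have "\<dots> \<longleftrightarrow> (\<forall>w. w v* A = 0 \<and> w v* B = 0 \<longrightarrow> w = 0)"
  proof -
    have "(\<Sum>i\<in>UNIV. c i *s row i C) = 0 \<longleftrightarrow> (\<chi> i. c i) v* A = 0 \<and> (\<chi> i. c i) v* B = 0" for c
      by (simp add: vec_eq_iff vector_matrix_mult_def row_def C_def all_split)
    then have "(\<forall>c. (\<Sum>i\<in>UNIV. c i *s row i C) = 0 \<longrightarrow> (\<forall>i. c i = 0)) \<longleftrightarrow>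
        (\<forall>c. (\<chi> i. c i) v* A = 0 \<and> (\<chi> i. c i) v* B = 0 \<longrightarrow> (\<chi> i. c i) = (0 :: 'a^'m))"
      by (simp add: vec_eq_iff)
    also have "\<dots> \<longleftrightarrow> (\<forall>w. w v* A = 0 \<and> w v* B = 0 \<longrightarrow> w = 0)"
    proof (intro iffI allI)
      fix w :: "'a^'m"
      assume "\<forall>c. (\<chi> i. c i) v* A = 0 \<and> (\<chi> i. c i) v* B = 0 \<longrightarrow> (\<chi> i. c i) = (0 :: 'a^'m)"
      from this[rule_format, of "vec_nth w"]
      show "w v* A = 0 \<and> w v* B = 0 \<longrightarrow> w = 0" by simp
    qed blast
    finally show ?thesis .
  qed
  also have "\<dots> \<longleftrightarrow> common_left_kernel A B = {0}"
    by (auto simp: common_left_kernel_def)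
  finally show ?thesis .
qed

lemma surj_word_map_iff:
  fixes A B :: "'a::alg_closed_field^2^2"
  assumes "k1 > 0" "k2 > 0" "A \<noteq> 0" "B \<noteq> 0"
  shows "surj (word_map k1 k2 A B) \<longleftrightarrow> common_left_kernel A B = {0}"
proof -
  have "surj (word_map k1 k2 A B) \<longleftrightarrow> (\<forall>M :: 'a^2^2. \<exists>X Y. M = A ** X + B ** Y)"
    unfolding range_word_map[OF assms] by (simp add: set_eq_iff)
  also have "\<dots> \<longleftrightarrow> (\<exists>X Y. A ** X + B ** Y = mat 1)"
  proof
    assume "\<exists>X Y. A ** X + B ** Y = mat 1"
    then obtain X Y where XY: "A ** X + B ** Y = mat 1" by blast
    have "M = A ** (X ** M) + B ** (Y ** M)" for M :: "'a^2^2"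
    proof -
      have "M = (A ** X + B ** Y) ** M"
        by (simp add: XY)
      then show ?thesis
        by (simp only: matrix_add_rdistrib matrix_mul_assoc)
    qed
    then show "\<forall>M :: 'a^2^2. \<exists>X Y. M = A ** X + B ** Y" by blast
  next
    assume "\<forall>M :: 'a^2^2. \<exists>X Y. M = A ** X + B ** Y"
    then obtain X Y :: "'a^2^2" where "mat 1 = A ** X + B ** Y" by blast
    then have "A ** X + B ** Y = mat 1" by (rule sym)
    then show "\<exists>X Y. A ** X + B ** Y = mat 1" by blast
  qed
  finally show ?thesis
    unfolding column_spaces_span_iff .
qed

section \<open>Common zero rows of conjugates\<close>

lemma conj_by_eq:
  fixes P :: "'a::field^2^2"
  assumes "P ** Q = mat 1"
  shows "invertible P" and "conj_by P X = P ** X ** Q"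
proof -
  show P: "invertible P"
    using assms by (auto simp: invertible_right_inverse)
  have "matrix_inv P = matrix_inv P ** P ** Q"
    by (simp add: assms flip: matrix_mul_assoc)
  then show "conj_by P X = P ** X ** Q"
    by (simp add: conj_by_def matrix_inv_mult_left P)
qed

lemma conj_by_conj_by:
  fixes P Q :: "'a::field^2^2"
  assumes "invertible P" "invertible Q"
  shows "conj_by P (conj_by Q X) = conj_by (P ** Q) X"
proof -
  obtain P' Q' where P': "P ** P' = mat 1" and Q': "Q ** Q' = mat 1"
    using assms by (auto simp: invertible_right_inverse)
  have PQ: "P ** Q ** (Q' ** P') = mat 1"
    by (metis P' Q' matrix_mul_assoc matrix_mul_rid)
  show ?thesis
    unfolding conj_by_eq(2)[OF P'] conj_by_eq(2)[OF Q'] conj_by_eq(2)[OF PQ]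
    by (simp add: matrix_mul_assoc)
qed

lemma row_eq_axis_mult: "row i A = axis i 1 v* A"
  for A :: "'a::semiring_1^'n^'m"
proof -
  have "(\<Sum>k\<in>UNIV. axis i 1 $ k * A $ k $ j) = (\<Sum>k\<in>UNIV. if k = i then A $ k $ j else 0)" for j
    by (intro sum.cong) (auto simp: axis_def)
  then show ?thesis
    by (simp add: vec_eq_iff row_def vector_matrix_mult_def)
qed

lemma vector_mult_invertible_eq_0_iff:
  fixes P :: "'a::field^'n^'n"
  assumes "invertible P"
  shows "w v* P = 0 \<longleftrightarrow> w = 0"
proof -
  obtain P' where "P ** P' = mat 1"
    using assms by (auto simp: invertible_def)
  then have w: "w v* P v* P' = w"
    by (simp add: vector_matrix_mul_assoc)
  show ?thesis
  proof
    assume "w v* P = 0"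
    with w show "w = 0" by simp
  qed simp
qed

lemma left_kernel_conj_by:
  fixes P :: "'a::field^2^2"
  assumes "invertible P"
  shows "w v* conj_by P X = 0 \<longleftrightarrow> w v* P v* X = 0"
proof -
  obtain P' where P': "P ** P' = mat 1" "P' ** P = mat 1"
    using assms by (auto simp: invertible_def)
  have "w v* conj_by P X = w v* P v* X v* P'"
    by (simp add: conj_by_eq(2)[OF P'(1)] vector_matrix_mul_assoc)
  moreover have "invertible P'"
    using P' by (auto simp: invertible_def)
  ultimately show ?thesis
    by (simp add: vector_mult_invertible_eq_0_iff)
qed

lemma common_left_kernel_eq_0_iff:
  "common_left_kernel A B = {0} \<longleftrightarrow> (\<forall>w. w v* A = 0 \<and> w v* B = 0 \<longrightarrow> w = 0)"
  by (auto simp: common_left_kernel_def)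

text \<open>
  A common zero row with index \<open>i\<close> of the conjugates means that row \<open>i\<close> of \<open>P\<close> annihilates \<open>A\<close> and \<open>B\<close>.
\<close>

lemma common_left_kernel_imp_disjoint_zero_rows:
  fixes A B :: "'a::field^2^2"
  assumes "common_left_kernel A B = {0}" and P: "invertible P"
  shows "disjoint_zero_rows (conj_by P A) (conj_by P B)"
  unfolding disjoint_zero_rows_def
proof
  assume "\<exists>i. row i (conj_by P A) = 0 \<and> row i (conj_by P B) = 0"
  then obtain i where "axis i 1 v* P v* A = 0 \<and> axis i 1 v* P v* B = 0"
    by (auto simp: row_eq_axis_mult left_kernel_conj_by P)
  then have "axis i (1 :: 'a) v* P = 0"
    using assms(1) common_left_kernel_eq_0_iff by blast
  then have "axis i (1 :: 'a) = 0"
    by (simp add: vector_mult_invertible_eq_0_iff P)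
  then show False by (simp add: axis_eq_0_iff)
qed

text \<open>
  Conversely, a nonzero row vector that annihilates both matrices can be completed to an invertible
  matrix \<open>P\<close> with that vector as its first row.
\<close>

lemma disjoint_zero_rows_conj_imp_common_left_kernel:
  fixes A B :: "'a::field^2^2"
  assumes disj: "\<And>P. invertible P \<Longrightarrow> disjoint_zero_rows (conj_by P A) (conj_by P B)"
  shows "common_left_kernel A B = {0}"
  unfolding common_left_kernel_eq_0_iff
proof (intro allI impI, rule ccontr)
  fix w assume w: "w v* A = 0 \<and> w v* B = 0" and "w \<noteq> 0"
  then consider "w $ 1 \<noteq> 0" | "w $ 2 \<noteq> 0"
    by (auto simp: vec_eq_iff forall_2)
  then obtain r s where "w $ 1 * s \<noteq> w $ 2 * r"
  proof cases
    case 1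
    then show ?thesis using that[of 1 0] by simp
  next
    case 2
    then show ?thesis using that[of 0 1] by simp
  qed
  define P where "P = mat2 (w $ 1) (w $ 2) r s"
  have P: "invertible P"
    using \<open>w $ 1 * s \<noteq> w $ 2 * r\<close> by (simp add: invertible_det_nz det_2 P_def)
  have "axis 1 1 v* P = w"
    unfolding row_eq_axis_mult[symmetric] by (simp add: row_def P_def vec_eq_iff forall_2)
  then have "row 1 (conj_by P A) = 0 \<and> row 1 (conj_by P B) = 0"
    using w by (simp add: row_eq_axis_mult left_kernel_conj_by P)
  then show False
    using disj[OF P] by (auto simp: disjoint_zero_rows_def)
qed

lemma common_left_kernel_conj_by:
  fixes A B :: "'a::field^2^2"
  assumes P: "invertible P" and "common_left_kernel (conj_by P A) (conj_by P B) = {0}"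
  shows "common_left_kernel A B = {0}"
proof -
  obtain P' where P': "P ** P' = mat 1" "P' ** P = mat 1"
    using P by (auto simp: invertible_def)
  have "w = 0" if "w v* A = 0 \<and> w v* B = 0" for w
  proof -
    have w: "w v* P' v* P = w"
      by (simp add: vector_matrix_mul_assoc P')
    then have "w v* P' v* conj_by P A = 0 \<and> w v* P' v* conj_by P B = 0"
      using that by (simp only: left_kernel_conj_by[OF P])
    then have "w v* P' = 0"
      using assms(2) unfolding common_left_kernel_eq_0_iff by blast
    then show ?thesis using w by simp
  qed
  then show ?thesis
    unfolding common_left_kernel_eq_0_iff by blast
qed

text \<open>
  The hypothesis says that one of the six minors of the block matrix of \<open>A\<close> and \<open>B\<close> is nonzero.
  This criterion contains no quantifiers and can thus be checked by simplification for each
  entry of the list.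
\<close>

lemma common_left_kernel_mat2:
  fixes a :: "'a::field"
  assumes "a * d \<noteq> b * c \<or> a' * d' \<noteq> b' * c' \<or> a * c' \<noteq> a' * c \<or> a * d' \<noteq> b' * c \<or>
    b * c' \<noteq> a' * d \<or> b * d' \<noteq> b' * d"
  shows "common_left_kernel (mat2 a b c d) (mat2 a' b' c' d') = {0}"
  unfolding common_left_kernel_eq_0_iff
proof (intro allI impI)
  fix w assume w: "w v* mat2 a b c d = 0 \<and> w v* mat2 a' b' c' d' = 0"
  define u v where "u = w $ 1" and "v = w $ 2"
  have eqs: "u * a + v * c = 0" "u * b + v * d = 0" "u * a' + v * c' = 0" "u * b' + v * d' = 0"
    using w by (simp_all add: vec_eq_iff forall_2 vector_matrix_mult_def sum_2 u_def v_def mult.commute)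
  have minor: "u = 0 \<and> v = 0"
    if "p * s \<noteq> r * q" "u * p + v * q = 0" "u * r + v * s = 0" for p q r s
  proof -
    have "u * (p * s - r * q) = (u * p + v * q) * s - (u * r + v * s) * q"
      and "v * (p * s - r * q) = (u * r + v * s) * p - (u * p + v * q) * r"
      by (simp_all add: algebra_simps)
    then show ?thesis using that by auto
  qed
  have "u = 0 \<and> v = 0"
    using assms eqs by (elim disjE) (rule minor; assumption)+
  then show "w = 0"
    by (simp add: u_def v_def vec_eq_iff forall_2)
qed

lemma disjoint_zero_rows_mat2:
  "disjoint_zero_rows (mat2 a b c d) (mat2 a' b' c' d') \<longleftrightarrow>
    (a, b, a', b') \<noteq> (0, 0, 0, 0) \<and> (c, d, c', d') \<noteq> (0, 0, 0, 0)"
  by (simp add: disjoint_zero_rows_def row_def vec_eq_iff forall_2)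

text \<open>
  If \<open>A\<close> is a singular nonzero matrix in Jordan form, then it has a zero row, and the corresponding
  unit vector spans its left kernel. The same row of \<open>B\<close> is nonzero, so this vector does not
  annihilate \<open>B\<close>.
\<close>

lemma jordan_form_disjoint_zero_rows:
  fixes A B :: "'a::field^2^2"
  assumes J: "jordan_form2 A" "A \<noteq> 0" and disj: "disjoint_zero_rows A B"
  shows "common_left_kernel A B = {0}"
proof -
  obtain a b c d where B: "B = mat2 a b c d"
    by (rule mat2_exhaust)
  consider l m where "A = diag2 l m" | l where "A = mat2 l 1 0 l"
    using J(1) by (auto simp: jordan_form2_def)
  then show ?thesis
    using J(2) disj unfolding B
    by cases (auto intro!: common_left_kernel_mat2 simp: disjoint_zero_rows_mat2 mat2_zero_iff)
qed

section \<open>The images of the listed pairs\<close>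

lemma listed_or_omitted_cases:
  assumes "listed A B V \<or> omitted A B V" "A \<noteq> 0" "B \<noteq> 0"
  shows "V = UNIV \<and> common_left_kernel A B = {0} \<or>
    V = top_rows \<and> row 2 A = 0 \<and> row 2 B = 0 \<or>
    V = bottom_rows \<and> row 1 A = 0 \<and> row 1 B = 0"
  using assms(1)
proof
  have row2: "row 2 (mat2 a b 0 0) = 0" and row1: "row 1 (mat2 0 0 c d) = 0" for a b c d :: 'a
    by (simp_all add: row_def vec_eq_iff forall_2)
  assume "listed A B V"
  then show ?thesis
    using assms(2,3)
    by cases (simp_all add: common_left_kernel_mat2 row1 row2 mat2_zero_iff)
next
  have row2: "row 2 (mat2 a b 0 0) = 0" for a b :: 'a
    by (simp add: row_def vec_eq_iff forall_2)
  assume "omitted A B V"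
  then show ?thesis
    using assms(2,3)
    by cases (auto intro!: common_left_kernel_mat2 simp: row2 mat2_zero_iff)
qed

text \<open>
  A nonzero row \<open>(p, q)\<close> times a matrix can be any row, so the summand \<open>A X\<close> alone fills up the space
  that the zero rows allow.
\<close>

lemma column_space_row:
  fixes A B :: "'a::field^2^2"
  assumes "A \<noteq> 0" 
  shows "row 2 A = 0 \<Longrightarrow> row 2 B = 0 \<Longrightarrow> {A ** X + B ** Y | X Y. True} = top_rows"
    and "row 1 A = 0 \<Longrightarrow> row 1 B = 0 \<Longrightarrow> {A ** X + B ** Y | X Y. True} = bottom_rows"
proof -
  obtain a b c d where A: "A = mat2 a b c d"
    by (rule mat2_exhaust)
  obtain a' b' c' d' where B: "B = mat2 a' b' c' d'"
    by (rule mat2_exhaust)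
  have solve: "\<exists>x y z w. p * x + q * z = s \<and> p * y + q * w = t" if "p \<noteq> 0 \<or> q \<noteq> 0" for p q s t :: 'a
  proof (cases "p = 0")
    case True
    then have "p * 0 + q * (s / q) = s \<and> p * 0 + q * (t / q) = t"
      using that by simp
    then show ?thesis by blast
  next
    case False
    then have "p * (s / p) + q * 0 = s \<and> p * (t / p) + q * 0 = t"
      by simp
    then show ?thesis by blast
  qed
  show "{A ** X + B ** Y | X Y. True} = top_rows" if "row 2 A = 0" "row 2 B = 0"
  proof (intro equalityI subsetI)
    have 0: "c = 0" "d = 0" "c' = 0" "d' = 0"
      using that by (auto simp: A B row_def vec_eq_iff forall_2)
    show "M \<in> top_rows" if "M \<in> {A ** X + B ** Y | X Y. True}" for M
      using that by (auto simp: top_rows_def mat2_eq_iff A B 0 matrix_matrix_mult_def sum_2)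
    fix M :: "'a^2^2" assume "M \<in> top_rows"
    then obtain s t where M: "M = mat2 s t 0 0" by (auto simp: top_rows_def)
    obtain x y z w where "a * x + b * z = s" "a * y + b * w = t"
      using solve[of a b s t] assms by (auto simp: A 0 mat2_zero_iff)
    then have "M = A ** mat2 x y z w + B ** 0"
      by (simp add: M A 0 mat2_mult)
    then show "M \<in> {A ** X + B ** Y | X Y. True}" by blast
  qed
  show "{A ** X + B ** Y | X Y. True} = bottom_rows" if "row 1 A = 0" "row 1 B = 0"
  proof (intro equalityI subsetI)
    have 0: "a = 0" "b = 0" "a' = 0" "b' = 0"
      using that by (auto simp: A B row_def vec_eq_iff forall_2)
    show "M \<in> bottom_rows" if "M \<in> {A ** X + B ** Y | X Y. True}" for M
      using that by (auto simp: bottom_rows_def mat2_eq_iff A B 0 matrix_matrix_mult_def sum_2)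
    fix M :: "'a^2^2" assume "M \<in> bottom_rows"
    then obtain s t where M: "M = mat2 0 0 s t" by (auto simp: bottom_rows_def)
    obtain x y z w where "c * x + d * z = s" "c * y + d * w = t"
      using solve[of c d s t] assms by (auto simp: A 0 mat2_zero_iff)
    then have "M = A ** mat2 x y z w + B ** 0"
      by (simp add: M A 0 mat2_mult)
    then show "M \<in> {A ** X + B ** Y | X Y. True}" by blast
  qed
qed

lemma range_word_map_listed_or_omitted:
  fixes A B :: "'a::alg_closed_field^2^2"
  assumes "k1 > 0" "k2 > 0" "A \<noteq> 0" "B \<noteq> 0" and "listed A B V \<or> omitted A B V"
  shows "range (word_map k1 k2 A B) = V"
  using listed_or_omitted_cases[OF assms(5,3,4)]
proof (elim disjE conjE)
  assume "V = UNIV" "common_left_kernel A B = {0}"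
  then show ?thesis
    using surj_word_map_iff[OF assms(1-4)] by simp
qed (simp_all only: range_word_map[OF assms(1-4)] column_space_row[OF assms(3)])

section \<open>Normal forms under simultaneous conjugation\<close>

lemma conj_by_shear:
  fixes q :: "'a::field"
  shows "invertible (mat2 1 q 0 1)"
    and "conj_by (mat2 1 q 0 1) (mat2 a b c d) =
      mat2 (a + q * c) (b + q * (d - a) - c * q\<^sup>2) c (d - q * c)"
proof -
  have inv: "mat2 1 q 0 1 ** mat2 1 (- q) 0 1 = mat 1"
    by (simp add: mat2_mult mat2_arith)
  show "invertible (mat2 1 q 0 1)"
    by (rule conj_by_eq(1)[OF inv])
  show "conj_by (mat2 1 q 0 1) (mat2 a b c d) =
      mat2 (a + q * c) (b + q * (d - a) - c * q\<^sup>2) c (d - q * c)"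
    by (simp add: conj_by_eq(2)[OF inv] mat2_mult mat2_inject power2_eq_square algebra_simps)
qed

lemma conj_by_diag:
  fixes t :: "'a::field"
  assumes "t \<noteq> 0"
  shows "invertible (diag2 t 1)"
    and "conj_by (diag2 t 1) (mat2 a b c d) = mat2 a (t * b) (c / t) d"
proof -
  have inv: "diag2 t 1 ** diag2 (1 / t) 1 = mat 1"
    using assms by (simp add: mat2_mult mat2_arith)
  show "invertible (diag2 t 1)"
    by (rule conj_by_eq(1)[OF inv])
  show "conj_by (diag2 t 1) (mat2 a b c d) = mat2 a (t * b) (c / t) d"
    using assms by (simp add: conj_by_eq(2)[OF inv] mat2_mult mat2_inject)
qed

lemma conj_by_swap:
  fixes a :: "'a::field"
  shows "invertible (mat2 0 1 1 0 :: 'a^2^2)"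
    and "conj_by (mat2 0 1 1 0) (mat2 a b c d) = mat2 d c b a"
proof -
  have inv: "mat2 0 1 1 0 ** mat2 0 1 1 0 = (mat 1 :: 'a^2^2)"
    by (simp add: mat2_mult mat2_arith)
  show "invertible (mat2 0 1 1 0 :: 'a^2^2)"
    by (rule conj_by_eq(1)[OF inv])
  show "conj_by (mat2 0 1 1 0) (mat2 a b c d) = mat2 d c b a"
    by (simp add: conj_by_eq(2)[OF inv] mat2_mult)
qed

text \<open>
  The upper right entry of the conjugate is a polynomial of degree two in \<open>q\<close>, so it vanishes for
  some \<open>q\<close>. Shears serve twice: they triangularize \<open>A\<close>, and they commute with
  a Jordan block, so that they normalize \<open>B\<close> when \<open>A\<close> is one.
\<close>

lemma shear_to_lower_triangular:
  fixes a b c d :: "'a::alg_closed_field"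
  assumes "c \<noteq> 0"
  obtains q x y where "conj_by (mat2 1 q 0 1) (mat2 a b c d) = mat2 x 0 c y"
proof -
  obtain q where "c * q\<^sup>2 + (a - d) * q + (- b) = 0"
    using quadratic_has_root[OF assms] .
  then have "b + q * (d - a) - c * q\<^sup>2 = 0"
    by (simp add: algebra_simps)
  then have "conj_by (mat2 1 q 0 1) (mat2 a b c d) = mat2 (a + q * c) 0 c (d - q * c)"
    unfolding conj_by_shear by (simp only:)
  then show ?thesis by (rule that)
qed

lemma jordan_form_exists:
  fixes A :: "'a::alg_closed_field^2^2"
  obtains P where "invertible P" "jordan_form2 (conj_by P A)"
proof -
  obtain a b c d where A: "A = mat2 a b c d"
    by (rule mat2_exhaust)
  have "\<exists>P x y z. invertible P \<and> conj_by P A = mat2 x y 0 z"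
  proof (cases "c = 0")
    case True
    then have "conj_by (mat2 1 0 0 1) A = mat2 a b 0 d"
      by (simp add: A conj_by_shear)
    then show ?thesis
      using conj_by_shear(1)[of "0 :: 'a"] by blast
  next
    case False
    then obtain q x y where q: "conj_by (mat2 1 q 0 1) A = mat2 x 0 c y"
      unfolding A by (rule shear_to_lower_triangular)
    have "conj_by (mat2 0 1 1 0 ** mat2 1 q 0 1) A = mat2 y c 0 x"
      by (simp add: q conj_by_swap conj_by_shear(1) flip: conj_by_conj_by)
    moreover have "invertible (mat2 0 1 1 0 ** mat2 1 q 0 1)"
      by (intro invertible_mult conj_by_swap conj_by_shear)
    ultimately show ?thesis by blast
  qed
  then obtain P x y z where P: "invertible P" "conj_by P A = mat2 x y 0 z"
    by blast
  have "\<exists>Q. invertible Q \<and> jordan_form2 (conj_by Q (mat2 x y 0 z))"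
  proof (cases "x = z")
    case False
    \<comment> \<open>A shear by \<open>q\<close> changes the upper right entry to \<open>y + q (z - x)\<close>.\<close>
    then have "conj_by (mat2 1 (y / (x - z)) 0 1) (mat2 x y 0 z) = diag2 x z"
      by (simp add: conj_by_shear mat2_inject field_simps)
    then show ?thesis
      using conj_by_shear(1) unfolding jordan_form2_def by metis
  next
    case True
    show ?thesis
    proof (cases "y = 0")
      case True
      then have "conj_by (diag2 1 1) (mat2 x y 0 z) = diag2 x z"
        by (simp add: conj_by_diag)
      then show ?thesis
        using conj_by_diag(1)[of "1 :: 'a"] unfolding jordan_form2_def by (metis zero_neq_one)
    next
      case False
      then have "conj_by (diag2 (1 / y) 1) (mat2 x y 0 z) = mat2 x 1 0 x"
        using \<open>x = z\<close> by (simp add: conj_by_diag)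
      then show ?thesis
        using conj_by_diag(1)[of "1 / y"] False unfolding jordan_form2_def
        by (metis divide_eq_0_iff zero_neq_one)
    qed
  qed
  then obtain Q where "invertible Q" "jordan_form2 (conj_by Q (conj_by P A))"
    using P by auto
  then show ?thesis
    using that[of "Q ** P"] P(1) by (simp add: conj_by_conj_by invertible_mult)
qed

definition classifiable :: "'a::field^2^2 \<Rightarrow> 'a^2^2 \<Rightarrow> bool" where
  "classifiable A B \<longleftrightarrow> (\<exists>P V. invertible P \<and>
     (listed (conj_by P A) (conj_by P B) V \<or> omitted (conj_by P A) (conj_by P B) V))"

text \<open>
  This permits normalizing a pair step by step.
\<close>

lemma classifiable_conj_by:
  fixes A B :: "'a::field^2^2"
  assumes P: "invertible P" and "classifiable (conj_by P A) (conj_by P B)"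
  shows "classifiable A B"
proof -
  obtain Q V where Q: "invertible Q" and
    "listed (conj_by Q (conj_by P A)) (conj_by Q (conj_by P B)) V \<or>
     omitted (conj_by Q (conj_by P A)) (conj_by Q (conj_by P B)) V"
    using assms unfolding classifiable_def by blast
  then have "listed (conj_by (Q ** P) A) (conj_by (Q ** P) B) V \<or>
     omitted (conj_by (Q ** P) A) (conj_by (Q ** P) B) V"
    by (simp add: conj_by_conj_by P)
  then show ?thesis
    using invertible_mult[OF Q P] unfolding classifiable_def by blast
qed

lemma classifiable_if_listed_or_omitted:
  fixes A B :: "'a::field^2^2"
  assumes "listed A B V \<or> omitted A B V"
  shows "classifiable A B"
proof -
  have inv: "mat 1 ** mat 1 = (mat 1 :: 'a^2^2)"
    by simp
  have "conj_by (mat 1) X = X" for X :: "'a^2^2"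
    by (simp add: conj_by_eq(2)[OF inv])
  then show ?thesis
    using assms conj_by_eq(1)[OF inv] unfolding classifiable_def by metis
qed

lemma classifiable_if_listed: "listed A B V \<Longrightarrow> classifiable A B"
  and classifiable_if_omitted: "omitted A B V \<Longrightarrow> classifiable A B"
  for A B :: "'a::field^2^2"
  using classifiable_if_listed_or_omitted by blast+

text \<open>
  The three lemmas below treat a diagonal \<open>A\<close> with distinct eigenvalues, according to whether the lower
  left entry of \<open>B\<close> has been scaled to \<open>1\<close>, or it is zero and the upper right entry has been scaled
  to \<open>1\<close>, or both are zero.
\<close>

lemma classifiable_diag_lower:
  fixes l m :: "'a::field"
  assumes "l \<noteq> m"
  shows "classifiable (diag2 l m) (mat2 a b 1 d)"
proof (cases "b = 0")
  case True
  consider "l * m \<noteq> 0" "a = d" | "l * m \<noteq> 0" "a \<noteq> d" | "m = 0" | "l = 0" "a \<noteq> 0" | "l = 0" "a = 0"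
    by auto
  then show ?thesis
    using assms True by cases (fastforce intro: c16 c19 c21 c22 c38 classifiable_if_listed)+
next
  case False
  consider "a \<noteq> 0" "d \<noteq> 0" | "a = 0" "d \<noteq> 0" | "a \<noteq> 0" "d = 0" | "a = 0" "d = 0"
    by auto
  then show ?thesis
    using assms False by cases (auto intro: c23 c25 c26 c27 classifiable_if_listed)
qed

lemma classifiable_diag_upper:
  fixes l m :: "'a::field"
  assumes "l \<noteq> m"
  shows "classifiable (diag2 l m) (mat2 a 1 0 d)"
proof -
  consider "l * m \<noteq> 0" "a = d" | "l * m \<noteq> 0" "a \<noteq> d" | "l * m = 0" "a * d \<noteq> 0"
    | "m = 0" "d = 0" | "m = 0" "d \<noteq> 0" "a = 0" | "l = 0" "d = 0" | "l = 0" "a = 0"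
    by auto
  then show ?thesis
    using assms
    by cases (fastforce intro: c8 c11 c12 c34 c14 c13 c15 classifiable_if_listed)+
qed

lemma classifiable_diag_diag:
  fixes l m :: "'a::field"
  assumes "l \<noteq> m"
  shows "classifiable (diag2 l m) (diag2 a d)"
proof -
  consider "a = d" | "a \<noteq> 0" "m \<noteq> 0" | "d \<noteq> 0" "l \<noteq> 0" | "a = 0" "l = 0" | "d = 0" "m = 0"
    using assms by auto
  then show ?thesis
    using assms by cases (auto intro: c4 c6 c7 c32 c36 classifiable_if_listed)
qed

lemma classifiable_diag:
  fixes l m :: "'a::field"
  assumes "l \<noteq> m"
  shows "classifiable (diag2 l m) B"
proof -
  obtain a b c d where B: "B = mat2 a b c d"
    by (rule mat2_exhaust)
  consider "c \<noteq> 0" | "c = 0" "b \<noteq> 0" | "c = 0" "b = 0" by blast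
  then show ?thesis
  proof cases
    case 1
    show ?thesis
      by (rule classifiable_conj_by[OF conj_by_diag(1)[OF 1]])
        (simp add: B conj_by_diag 1 classifiable_diag_lower assms)
  next
    case 2
    then have t: "1 / b \<noteq> 0" by simp
    show ?thesis
      by (rule classifiable_conj_by[OF conj_by_diag(1)[OF t]])
        (use 2 in \<open>simp add: B conj_by_diag(2)[OF t] classifiable_diag_upper assms\<close>)
  next
    case 3
    then show ?thesis by (simp add: B classifiable_diag_diag assms)
  qed
qed

lemma conj_by_scalar:
  fixes P :: "'a::field^2^2"
  assumes "invertible P"
  shows "conj_by P (diag2 l l) = diag2 l l"
proof -
  obtain P' where P': "P ** P' = mat 1"
    using assms by (auto simp: invertible_def)
  obtain a b c d where P: "P = mat2 a b c d"
    by (rule mat2_exhaust)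
  have "P ** diag2 l l = diag2 l l ** P"
    by (simp add: P mat2_mult mult.commute)
  then show ?thesis
    by (simp add: conj_by_eq(2)[OF P'] P' flip: matrix_mul_assoc)
qed

text \<open>
  A scalar \<open>A\<close> is fixed by conjugation, which can thus be used to bring \<open>B\<close> to Jordan form.
\<close>

lemma classifiable_scalar:
  fixes B :: "'a::alg_closed_field^2^2"
  shows "classifiable (diag2 l l) B"
proof -
  obtain P where P: "invertible P" "jordan_form2 (conj_by P B)"
    by (rule jordan_form_exists)
  have "classifiable (diag2 l l) (conj_by P B)"
    using P(2) unfolding jordan_form2_def
  proof (elim disjE exE)
    fix x y
    assume "conj_by P B = diag2 x y"
    then show ?thesis
      by (cases "x = y") (auto intro: classifiable_if_listed c1 c2)
  next
    fix x
    assume "conj_by P B = mat2 x 1 0 x"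
    then show ?thesis
      by (auto intro: classifiable_if_listed[OF c3])
  qed
  then show ?thesis
    using classifiable_conj_by[OF P(1)] conj_by_scalar[OF P(1)] by metis
qed

text \<open>
  Shears fix \<open>A\<close>. If the lower left entry of \<open>B\<close> is nonzero, then a shear makes \<open>B\<close> lower
  triangular; if it is zero, then a shear makes \<open>B\<close> diagonal unless its two eigenvalues agree.
\<close>

lemma classifiable_jordan_block:
  fixes B :: "'a::alg_closed_field^2^2"
  assumes "B \<noteq> 0"
  shows "classifiable (mat2 l 1 0 l) B"
proof -
  have block: "conj_by (mat2 1 q 0 1) (mat2 l 1 0 l) = mat2 l 1 0 l" for q
    by (simp add: conj_by_shear)
  have shear: "classifiable (mat2 l 1 0 l) B"
    if "conj_by (mat2 1 q 0 1) B = B'" "classifiable (mat2 l 1 0 l) B'" for q B'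
    using classifiable_conj_by[OF conj_by_shear(1), of q] that block by metis
  obtain a b c d where B: "B = mat2 a b c d"
    by (rule mat2_exhaust)
  show ?thesis
  proof (cases "c = 0")
    case False
    then obtain q x y where q: "conj_by (mat2 1 q 0 1) B = mat2 x 0 c y"
      unfolding B by (rule shear_to_lower_triangular)
    consider "l \<noteq> 0" "x \<noteq> y" | "l \<noteq> 0" "x = y" "x \<noteq> 0" | "l \<noteq> 0" "x = 0" "y = 0"
      | "l = 0" "x \<noteq> y" | "l = 0" "x = y"
      by auto
    then have "classifiable (mat2 l 1 0 l) (mat2 x 0 c y)"
      using False
      by cases (fastforce intro: c28 c29 o1 o2 o3 classifiable_if_listed classifiable_if_omitted)+
    then show ?thesis by (rule shear[OF q])
  next
    case c: True
    show ?thesis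
    proof (cases "a = d")
      case False
      then have q: "conj_by (mat2 1 (b / (a - d)) 0 1) B = diag2 a d"
        by (simp add: B c conj_by_shear mat2_inject field_simps)
      consider "l \<noteq> 0" | "l = 0" "d \<noteq> 0" | "l = 0" "d = 0"
        by auto
      then have "classifiable (mat2 l 1 0 l) (diag2 a d)"
        using False
        by cases (auto intro: c30 o4 o6 classifiable_if_listed classifiable_if_omitted)
      then show ?thesis by (rule shear[OF q])
    next
      case True
      then consider "a \<noteq> 0" | "a = 0" "b \<noteq> 0" "l \<noteq> 0" | "a = 0" "b \<noteq> 0" "l = 0"
        using assms by (auto simp: B c mat2_zero_iff)
      then show ?thesis
        unfolding B c True[symmetric]
        by cases (auto intro: c31 c35 o5 classifiable_if_listed classifiable_if_omitted)
    qed
  qed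
qed

lemma all_classifiable:
  fixes A B :: "'a::alg_closed_field^2^2"
  assumes "B \<noteq> 0"
  shows "classifiable A B"
proof -
  obtain P where P: "invertible P" "jordan_form2 (conj_by P A)"
    by (rule jordan_form_exists)
  have "conj_by P B \<noteq> 0"
    using assms P by (simp add: conj_by_eq_0_iff)
  then have "classifiable (conj_by P A) (conj_by P B)"
    using P(2) classifiable_diag classifiable_scalar classifiable_jordan_block
    unfolding jordan_form2_def by metis
  then show ?thesis
    by (rule classifiable_conj_by[OF P(1)])
qed

section \<open>The classification of images\<close>

theorem theorem1:
  fixes A B :: "'a::alg_closed_field^2^2" and k1 k2 :: nat
  assumes "k1 > 0" and "k2 > 0" and "A \<noteq> 0" and "B \<noteq> 0"
  shows
    "(surj (word_map k1 k2 A B) \<longleftrightarrow>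
        (\<exists>P. invertible P \<and> jordan_form2 (conj_by P A) \<and>
             disjoint_zero_rows (conj_by P A) (conj_by P B))) \<and>
     (surj (word_map k1 k2 A B) \<longleftrightarrow>
        (\<forall>P. invertible P \<longrightarrow> disjoint_zero_rows (conj_by P A) (conj_by P B))) \<and>
     (\<forall>V. listed A B V \<or> omitted A B V \<longrightarrow> range (word_map k1 k2 A B) = V) \<and>
     (\<exists>P V. invertible P \<and>
        (listed (conj_by P A) (conj_by P B) V \<or> omitted (conj_by P A) (conj_by P B) V)) \<and>
     module.subspace mat_scale (range (word_map k1 k2 A B))"
proof (intro conjI)
  note surj_iff = surj_word_map_iff[OF assms]
  have all: "surj (word_map k1 k2 A B) \<longleftrightarrow>
      (\<forall>P. invertible P \<longrightarrow> disjoint_zero_rows (conj_by P A) (conj_by P B))"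
    unfolding surj_iff
  proof (intro iffI allI impI)
    fix P :: "'a^2^2" assume "common_left_kernel A B = {0}" "invertible P"
    then show "disjoint_zero_rows (conj_by P A) (conj_by P B)"
      by (rule common_left_kernel_imp_disjoint_zero_rows)
  next
    assume "\<forall>P. invertible P \<longrightarrow> disjoint_zero_rows (conj_by P A) (conj_by P B)"
    then show "common_left_kernel A B = {0}"
      by (intro disjoint_zero_rows_conj_imp_common_left_kernel) simp
  qed
  then show "surj (word_map k1 k2 A B) \<longleftrightarrow>
      (\<forall>P. invertible P \<longrightarrow> disjoint_zero_rows (conj_by P A) (conj_by P B))" .
  show "surj (word_map k1 k2 A B) \<longleftrightarrow>
      (\<exists>P. invertible P \<and> jordan_form2 (conj_by P A) \<and>
           disjoint_zero_rows (conj_by P A) (conj_by P B))"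
  proof
    assume surj: "surj (word_map k1 k2 A B)"
    obtain P where "invertible P" "jordan_form2 (conj_by P A)"
      by (rule jordan_form_exists)
    with surj all show "\<exists>P. invertible P \<and> jordan_form2 (conj_by P A) \<and>
        disjoint_zero_rows (conj_by P A) (conj_by P B)"
      by blast
  next
    assume "\<exists>P. invertible P \<and> jordan_form2 (conj_by P A) \<and>
        disjoint_zero_rows (conj_by P A) (conj_by P B)"
    then obtain P where P: "invertible P" "jordan_form2 (conj_by P A)"
      "disjoint_zero_rows (conj_by P A) (conj_by P B)" by blast
    then have "common_left_kernel (conj_by P A) (conj_by P B) = {0}"
      using assms by (intro jordan_form_disjoint_zero_rows) (simp_all add: conj_by_eq_0_iff)
    then show "surj (word_map k1 k2 A B)"
      unfolding surj_iff by (rule common_left_kernel_conj_by[OF P(1)])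
  qed
  show "\<forall>V. listed A B V \<or> omitted A B V \<longrightarrow> range (word_map k1 k2 A B) = V"
    using range_word_map_listed_or_omitted[OF assms] by blast
  show "\<exists>P V. invertible P \<and>
      (listed (conj_by P A) (conj_by P B) V \<or> omitted (conj_by P A) (conj_by P B) V)"
    using all_classifiable[OF assms(4)] unfolding classifiable_def .
  show "module.subspace mat_scale (range (word_map k1 k2 A B))"
    by (rule subspace_range_word_map[OF assms])
qed

end
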